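(* Let $(A,\alpha,1_\star)$ be a unital hom-associative algebra, where $1_\star$ is a left, right or two-sided unity. The following statements are equivalent: 1) $\alpha$ is multiplicative; 2) $\alpha$ is idempotent; 3) $\alpha^2(1_\star)=\alpha(1_\star)$; 4) $\alpha(1_\star)$ is idempotent.
   Context: An algebra $A$ over a field $\mathbb{F}$ is a linear space with a bilinear product $(x,y)\mapsto x\cdot y$ (not assumed associative, commutative or unital). A hom-associative algebra $(A,\alpha)$ is an algebra $A$ with a linear map $\alpha\colon A\to A$ such that $\alpha(x)\cdot(y\cdot z)=(x\cdot y)\cdot\alpha(z)$ for all $x,y,z\in A$. A unity is an element $1_\star\in A$ such that $1_\star\cdot x=x$ for all $x\in A$ (left unity), or $x\cdot 1_\star=x$ for all $x\in A$ (right unity), or both (two-sided unity). The map $\alpha$ is multiplicative if $\alpha(x\cdot y)=\alpha(x)\cdot\alpha(y)$ for all $x,y\in A$; it is idempotent if $\alpha\circ\alpha=\alpha$; here $\alpha^2=\alpha\circ\alpha$. An element $e\in A$ is idempotent if $e\cdot e=e$. *)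

theory Defs
  imports Complex_Main
begin

text \<open>
  Algebras are not assumed associative, commutative or unital. The underlying space is a whole
  type \<open>'a\<close>, over an arbitrary field \<open>'f\<close> acting through \<open>scale\<close>, as in the library's
  \<open>vector_space\<close>; the product is an explicit operation because the type class
  products come with associativity.
\<close>

locale nonassoc_algebra = vector_space scale
  for scale :: "'f::field \<Rightarrow> 'a::ab_group_add \<Rightarrow> 'a" +
  fixes mult :: "'a \<Rightarrow> 'a \<Rightarrow> 'a"
  assumes linear_mult_left: "Vector_Spaces.linear scale scale (\<lambda>x. mult x y)"
    and linear_mult_right: "Vector_Spaces.linear scale scale (\<lambda>y. mult x y)"

locale hom_assoc_algebra = nonassoc_algebra scale mult
  for scale :: "'f::field \<Rightarrow> 'a::ab_group_add \<Rightarrow> 'a"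
    and mult :: "'a \<Rightarrow> 'a \<Rightarrow> 'a" +
  fixes \<alpha> :: "'a \<Rightarrow> 'a"
  assumes linear_twist: "Vector_Spaces.linear scale scale \<alpha>"
    and hom_assoc: "mult (\<alpha> x) (mult y z) = mult (mult x y) (\<alpha> z)"

definition left_unity :: "('a \<Rightarrow> 'a \<Rightarrow> 'a) \<Rightarrow> 'a \<Rightarrow> bool" where
  "left_unity mult u \<longleftrightarrow> (\<forall>x. mult u x = x)"

definition right_unity :: "('a \<Rightarrow> 'a \<Rightarrow> 'a) \<Rightarrow> 'a \<Rightarrow> bool" where
  "right_unity mult u \<longleftrightarrow> (\<forall>x. mult x u = x)"

definition two_sided_unity :: "('a \<Rightarrow> 'a \<Rightarrow> 'a) \<Rightarrow> 'a \<Rightarrow> bool" where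
  "two_sided_unity mult u \<longleftrightarrow> left_unity mult u \<and> right_unity mult u"

locale unital_hom_assoc_algebra = hom_assoc_algebra scale mult \<alpha>
  for scale :: "'f::field \<Rightarrow> 'a::ab_group_add \<Rightarrow> 'a"
    and mult :: "'a \<Rightarrow> 'a \<Rightarrow> 'a"
    and \<alpha> :: "'a \<Rightarrow> 'a" +
  fixes unity :: 'a
  assumes unity: "left_unity mult unity \<or> right_unity mult unity \<or> two_sided_unity mult unity"

definition multiplicative_map :: "('a \<Rightarrow> 'a \<Rightarrow> 'a) \<Rightarrow> ('a \<Rightarrow> 'a) \<Rightarrow> bool" where
  "multiplicative_map mult f \<longleftrightarrow> (\<forall>x y. f (mult x y) = mult (f x) (f y))"

definition idempotent_map :: "('a \<Rightarrow> 'a) \<Rightarrow> bool" where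
  "idempotent_map f \<longleftrightarrow> f \<circ> f = f"

definition idempotent_element :: "('a \<Rightarrow> 'a \<Rightarrow> 'a) \<Rightarrow> 'a \<Rightarrow> bool" where
  "idempotent_element mult e \<longleftrightarrow> mult e e = e"

end

theory Submission
  imports Defs
begin

text \<open>
  Write \<open>u\<close> for the unity. Hom-associativity is symmetric under passing to the opposite product,
  which exchanges left and right unities, so it is enough to treat a right unity. There the twist
  is completely determined by the single element \<open>\<alpha> u\<close>: putting \<open>u\<close> in the last two slots of
  hom-associativity gives \<open>\<alpha> x = x \<cdot> \<alpha> u\<close>. Hence \<open>\<alpha> (\<alpha> u) = \<alpha> u \<cdot> \<alpha> u\<close>, which is why fixing
  \<open>\<alpha> u\<close> and idempotency of \<open>\<alpha> u\<close> are the same condition. If \<open>\<alpha> u\<close> is fixed, hom-associativity with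
  \<open>\<alpha> u\<close> in the last slot reads \<open>\<alpha> x \<cdot> \<alpha> y = (x \<cdot> y) \<cdot> \<alpha> u\<close>, and the right-hand side is
  \<open>\<alpha> (x \<cdot> y)\<close>, so \<open>\<alpha>\<close> is multiplicative. Conversely, a multiplicative \<open>\<alpha>\<close> satisfies
  \<open>\<alpha> x = \<alpha> (x \<cdot> u) = \<alpha> x \<cdot> \<alpha> u = \<alpha> (\<alpha> x)\<close>.
\<close>

text \<open>
  The unity can be cancelled everywhere in \<open>\<alpha> x \<cdot> (u \<cdot> u) = (x \<cdot> u) \<cdot> \<alpha> u\<close> except under the twist.
\<close>

lemma right_unity_twist_eq_mult:
  assumes hom_assoc: "\<And>x y z. mult (\<alpha> x) (mult y z) = mult (mult x y) (\<alpha> z)"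
    and right_unity: "right_unity mult u"
  shows "\<alpha> x = mult x (\<alpha> u)"
  using hom_assoc[of x u u] right_unity by (simp add: right_unity_def)

text \<open>
  The product is an arbitrary operation here so that it can be replaced by its opposite, which
  reduces a left unity to a right one.
\<close>

lemma right_unity_equivalences:
  assumes hom_assoc: "\<And>x y z. mult (\<alpha> x) (mult y z) = mult (mult x y) (\<alpha> z)"
    and right_unity: "right_unity mult u"
  shows "multiplicative_map mult \<alpha> \<longleftrightarrow> idempotent_map \<alpha>"
    and "idempotent_map \<alpha> \<longleftrightarrow> \<alpha> (\<alpha> u) = \<alpha> u"
    and "\<alpha> (\<alpha> u) = \<alpha> u \<longleftrightarrow> idempotent_element mult (\<alpha> u)"
proof -
  note twist = right_unity_twist_eq_mult[of mult \<alpha>, OF hom_assoc right_unity]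
  have idempotent: "idempotent_map \<alpha>" if mult: "multiplicative_map mult \<alpha>"
  proof -
    have "\<alpha> (\<alpha> x) = \<alpha> x" for x
    proof -
      have "\<alpha> (\<alpha> x) = mult (\<alpha> x) (\<alpha> u)" by (rule twist)
      also have "\<dots> = \<alpha> (mult x u)" using mult by (simp add: multiplicative_map_def)
      also have "\<dots> = \<alpha> x" using right_unity by (simp add: right_unity_def)
      finally show ?thesis .
    qed
    then show ?thesis by (simp add: idempotent_map_def fun_eq_iff)
  qed
  have fixed: "\<alpha> (\<alpha> u) = \<alpha> u" if "idempotent_map \<alpha>"
    using that by (simp add: idempotent_map_def fun_eq_iff)
  have multiplicative: "multiplicative_map mult \<alpha>" if fixed: "\<alpha> (\<alpha> u) = \<alpha> u"
    unfolding multiplicative_map_def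
  proof (intro allI)
    fix x y
    have "\<alpha> (mult x y) = mult (mult x y) (\<alpha> u)" by (rule twist)
    also have "\<dots> = mult (mult x y) (\<alpha> (\<alpha> u))" by (simp only: fixed)
    also have "\<dots> = mult (\<alpha> x) (mult y (\<alpha> u))" by (rule hom_assoc[symmetric])
    also have "\<dots> = mult (\<alpha> x) (\<alpha> y)" by (simp only: twist[of y, symmetric])
    finally show "\<alpha> (mult x y) = mult (\<alpha> x) (\<alpha> y)" .
  qed
  show "multiplicative_map mult \<alpha> \<longleftrightarrow> idempotent_map \<alpha>"
    and "idempotent_map \<alpha> \<longleftrightarrow> \<alpha> (\<alpha> u) = \<alpha> u"
    using idempotent fixed multiplicative by blast+
  show "\<alpha> (\<alpha> u) = \<alpha> u \<longleftrightarrow> idempotent_element mult (\<alpha> u)"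
    by (simp only: idempotent_element_def twist[of "\<alpha> u"])
qed

theorem theorem16:
  fixes scale :: "'f::field \<Rightarrow> 'a::ab_group_add \<Rightarrow> 'a"
    and mult :: "'a \<Rightarrow> 'a \<Rightarrow> 'a"
    and \<alpha> :: "'a \<Rightarrow> 'a"
    and unity :: 'a
  assumes "unital_hom_assoc_algebra scale mult \<alpha> unity"
  shows "(multiplicative_map mult \<alpha> \<longleftrightarrow> idempotent_map \<alpha>) \<and>
         (idempotent_map \<alpha> \<longleftrightarrow> (\<alpha> \<circ> \<alpha>) unity = \<alpha> unity) \<and>
         ((\<alpha> \<circ> \<alpha>) unity = \<alpha> unity \<longleftrightarrow> idempotent_element mult (\<alpha> unity))"
proof -
  interpret unital_hom_assoc_algebra scale mult \<alpha> unity by (rule assms)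
  consider (right) "right_unity mult unity" | (left) "left_unity mult unity"
    using unity by (auto simp: two_sided_unity_def)
  then show ?thesis
  proof cases
    case right
    show ?thesis
      using right_unity_equivalences[of mult \<alpha>, OF hom_assoc right] by simp
  next
    case left
    let ?op = "\<lambda>x y. mult y x"
    have op_hom_assoc: "?op (\<alpha> x) (?op y z) = ?op (?op x y) (\<alpha> z)" for x y z
      by (rule hom_assoc[symmetric])
    have op_right: "right_unity ?op unity"
      using left by (simp add: left_unity_def right_unity_def)
    have "multiplicative_map ?op \<alpha> \<longleftrightarrow> multiplicative_map mult \<alpha>"
      by (auto simp: multiplicative_map_def)
    moreover have "idempotent_element ?op (\<alpha> unity) \<longleftrightarrow> idempotent_element mult (\<alpha> unity)"
      by (simp add: idempotent_element_def)
    ultimately show ?thesis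
      using right_unity_equivalences[of ?op \<alpha>, OF op_hom_assoc op_right] by simp
  qed
qed

end
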